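(* The transformation $$(1,g_2,g_3,g_4,g_5)\mapsto(1,g_2,g_2g_3,g_4,g_5)$$ corresponds to the map $\widetilde\Xi(5)\to\widetilde\Xi(5)$ given by $$\widetilde p=p;\qquad \widetilde q_2=q_2,\quad \widetilde q_3=q_3;\qquad \widetilde q_1=-r_1+2pq_1;\qquad \widetilde r_2=r_2,\quad \widetilde r_3=r_3;$$ $$\widetilde t_{1j}=p\,t_{1j}-q_jr_1+q_1r_j\mp\det\begin{pmatrix} 1 & p & q_1 & q_j \\ p & 1 & r_1 & r_j \\ q_1 & r_1 & 1 & t_{1j} \\ q_j & r_j & t_{1j} & 1 \end{pmatrix}^{1/2},\qquad j=2,3;$$ $$\widetilde t_{23}=t_{23}.$$
   Context: $\Pi(5)$ is the set of $5$-tuples $(g_1,\dots,g_5)$ of elements of $\mathrm{SU}(2)$ modulo $(g_1,\dots,g_5)\sim(hg_1q,\dots,hg_5q)$, $h,q\in\mathrm{SU}(2)$; equivalently, the set of tuples $(1,g_2,\dots,g_5)$ modulo simultaneous conjugation. The spectral form of a tuple is the quadratic form $\det(\lambda g_1+\mu g_2+\nu_1g_3+\nu_2g_4+\nu_3g_5)$ in real variables $\lambda,\mu,\nu_1,\nu_2,\nu_3$; its symmetric matrix (in this order of variables) is written $$\begin{pmatrix} 1 & p & q_1 & q_2 & q_3 \\ p & 1 & r_1 & r_2 & r_3 \\ q_1 & r_1 & 1 & t_{12} & t_{13} \\ q_2 & r_2 & t_{12} & 1 & t_{23} \\ q_3 & r_3 & t_{13} & t_{23} & 1 \end{pmatrix}.$$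 Letters with a tilde denote the corresponding entries for the transformed tuple. $\Xi(5)$ is the set of all real positive semidefinite quadratic forms in $5$ variables of rank $\le 4$ with all diagonal coefficients equal to $1$; the map $\Pi(5)\to\Xi(5)$ sending a tuple to its spectral form is surjective, two-to-one over forms of rank $4$ and one-to-one over forms of rank $\le 3$. $\widetilde\Xi(5)\to\Xi(5)$ denotes the corresponding two-sheeted covering (branched along rank $\le3$): a point of $\widetilde\Xi(5)$ is a spectral form together with a choice of sheet, i.e. of one of the two preimages in $\Pi(5)$. Choice of the sign $\mp$: represent the point of $\Pi(5)$ by a tuple with $g_1=1$, $g_2=\mathrm{diag}(e^{i\phi},e^{-i\phi})$, $0\le\phi\le\pi$, and $g_{k+2}=\begin{pmatrix} a_k & b_k \\ -\overline{b_k} & \overline{a_k}\end{pmatrix}$, $b_k=|b_k|e^{i\theta_k}$, $k=1,2,3$. The spectral form determines the differences $\theta_1-\theta_2$, $\theta_1-\theta_3$, $\theta_2-\theta_3$ up to sign, as $\theta_i-\theta_j=\pm\arccos(\cdot)$ of an expression in the entries of the form. The signs must be consistent, so that only two variants are possible, and they correspond to the choice of sheet of $\widetilde\Xi(5)\to\Xi(5)$. Once the signs are chosen, one takes "minus" in the formula for $\widetilde t_{1j}$ if $\theta_1-\theta_j\ge0$, and "plus" otherwise. *)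

theory Defs
  imports "HOL-Analysis.Analysis"
begin

type_synonym mat2 = "complex^2^2"

definition SU2 :: "mat2 set" where
  "SU2 = {A. A ** (\<chi> i j. cnj (A $ j $ i)) = mat 1 \<and> det A = 1}"

text \<open>
  The index type \<open>5\<close> is used with the indices \<open>1, 2, 3, 4, 5\<close> (where \<open>5 = 0\<close>), as
  \<^const>\<open>vector\<close> does.
\<close>

definition tuples5 :: "(mat2^5) set" where
  "tuples5 = {g. \<forall>i. g $ i \<in> SU2}"

definition tuple_rel :: "((mat2^5) \<times> (mat2^5)) set" where
  "tuple_rel = {(g, g'). g \<in> tuples5 \<and> g' \<in> tuples5 \<and>
     (\<exists>h\<in>SU2. \<exists>q\<in>SU2. \<forall>i. g' $ i = h ** g $ i ** q)}"

definition Pi5 :: "(mat2^5) set set" where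
  "Pi5 = tuples5 // tuple_rel"

text \<open>A quadratic form in five real variables is represented by its symmetric matrix.\<close>

definition spectral_matrix :: "mat2^5 \<Rightarrow> real^5^5" where
  "spectral_matrix g = (THE M. transpose M = M \<and>
     (\<forall>x::real^5. det (\<Sum>i\<in>UNIV. x $ i *\<^sub>R g $ i) = complex_of_real (x \<bullet> (M *v x))))"

definition Xi5 :: "(real^5^5) set" where
  "Xi5 = {M. transpose M = M \<and> (\<forall>x. 0 \<le> x \<bullet> (M *v x)) \<and> rank M \<le> 4 \<and> (\<forall>i. M $ i $ i = 1)}"

text \<open>The common spectral form of all tuples in a class.\<close>

definition spectral_of_class :: "(mat2^5) set \<Rightarrow> real^5^5" where
  "spectral_of_class X = the_elem (spectral_matrix ` X)"

text \<open>A point of the covering is a form together with one of its preimages in \<^const>\<open>Pi5\<close>.\<close>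

definition Xi5_tilde :: "((real^5^5) \<times> (mat2^5) set) set" where
  "Xi5_tilde = {(M, X). M \<in> Xi5 \<and> X \<in> Pi5 \<and> spectral_of_class X = M}"

definition to_tilde :: "(mat2^5) set \<Rightarrow> (real^5^5) \<times> (mat2^5) set" where
  "to_tilde X = (spectral_of_class X, X)"

text \<open>
  The transformation \<open>(1, g\<^sub>2, g\<^sub>3, g\<^sub>4, g\<^sub>5) \<mapsto> (1, g\<^sub>2, g\<^sub>2 g\<^sub>3, g\<^sub>4, g\<^sub>5)\<close>, on classes as the union
  over all representatives with first entry \<open>1\<close>. The result lies in \<^const>\<open>Pi5\<close> only if the
  classes of the images of all these representatives coincide.
\<close>

definition transform_tuple :: "mat2^5 \<Rightarrow> mat2^5" where
  "transform_tuple g = vector [g $ 1, g $ 2, g $ 2 ** g $ 3, g $ 4, g $ 5]"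

definition transform_class :: "(mat2^5) set \<Rightarrow> (mat2^5) set" where
  "transform_class X = (\<Union>g\<in>{g\<in>X. g $ 1 = mat 1}. tuple_rel `` {transform_tuple g})"

definition coef_p :: "real^5^5 \<Rightarrow> real" where
  "coef_p M = M $ 1 $ 2"

definition coef_q :: "real^5^5 \<Rightarrow> nat \<Rightarrow> real" where
  "coef_q M k = M $ 1 $ of_nat (k + 2)"

definition coef_r :: "real^5^5 \<Rightarrow> nat \<Rightarrow> real" where
  "coef_r M k = M $ 2 $ of_nat (k + 2)"

definition coef_t :: "real^5^5 \<Rightarrow> nat \<Rightarrow> nat \<Rightarrow> real" where
  "coef_t M k l = M $ of_nat (k + 2) $ of_nat (l + 2)"

definition minor4 :: "real^5^5 \<Rightarrow> nat \<Rightarrow> real^4^4" where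
  "minor4 M j = vector [
     vector [1,          coef_p M,   coef_q M 1,   coef_q M j],
     vector [coef_p M,   1,          coef_r M 1,   coef_r M j],
     vector [coef_q M 1, coef_r M 1, 1,            coef_t M 1 j],
     vector [coef_q M j, coef_r M j, coef_t M 1 j, 1]]"

definition su2_matrix :: "complex \<Rightarrow> complex \<Rightarrow> mat2" where
  "su2_matrix a b = vector [vector [a, b], vector [- cnj b, cnj a]]"

text \<open>
  \<open>angle_diffs X \<delta>\<close>: \<open>\<delta> i j\<close> is the difference \<open>\<theta>\<^sub>i - \<theta>\<^sub>j\<close> for a normalized representative of the
  class \<open>X\<close>. As the differences are of the form \<open>\<plusminus> arccos c\<close>, they are taken modulo \<open>2\<pi>\<close> in
  \<open>[-\<pi>, \<pi>]\<close>. If \<open>b\<^sub>k = 0\<close> then \<open>\<theta>\<^sub>k\<close> is arbitrary, and \<open>\<delta>\<close> is not unique.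
\<close>

definition angle_diffs :: "(mat2^5) set \<Rightarrow> (nat \<Rightarrow> nat \<Rightarrow> real) \<Rightarrow> bool" where
  "angle_diffs X \<delta> \<longleftrightarrow> (\<exists>(\<phi>::real) (a :: nat \<Rightarrow> complex) (b :: nat \<Rightarrow> complex) (\<theta> :: nat \<Rightarrow> real).
     0 \<le> \<phi> \<and> \<phi> \<le> pi \<and>
     vector [mat 1,
             su2_matrix (cis \<phi>) 0,
             su2_matrix (a 1) (b 1), su2_matrix (a 2) (b 2), su2_matrix (a 3) (b 3)] \<in> X \<and>
     (\<forall>k\<in>{1..3}. b k = complex_of_real (cmod (b k)) * cis (\<theta> k)) \<and>
     (\<forall>i\<in>{1..3}. \<forall>j\<in>{1..3}. i < j \<longrightarrow>
        \<bar>\<delta> i j\<bar> \<le> pi \<and> cis (\<delta> i j) = cis (\<theta> i - \<theta> j)))"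

end

theory Submission
  imports Defs
begin

text \<open>
  On real linear combinations of elements of SU(2) the determinant is the Euclidean norm squared of
  \<open>\<real>\<^sup>4\<close>, so the spectral form is the Gram matrix of the \<open>g\<^sub>i\<close>. For a normalized tuple, left
  multiplication by \<open>g\<^sub>2 = diag(e\<^sup>i\<^sup>\<phi>, e\<^sup>-\<^sup>i\<^sup>\<phi>)\<close> multiplies \<open>a\<^sub>1\<close> and \<open>b\<^sub>1\<close> by \<open>e\<^sup>i\<^sup>\<phi>\<close>. The only part of
  the new \<open>t\<^sub>1\<^sub>j\<close> that is not polynomial in the old entries is \<open>- sin \<phi> |b\<^sub>1| |b\<^sub>j| sin (\<theta>\<^sub>1 - \<theta>\<^sub>j)\<close>,
  up to sign the determinant of the coordinates of \<open>1, g\<^sub>2, g\<^sub>3, g\<^bsub>j+2\<^esub>\<close> in \<open>\<real>\<^sup>4\<close>; hence its square is the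
  Gram determinant, and its sign is opposite to that of \<open>\<theta>\<^sub>1 - \<theta>\<^sub>j\<close>, taken in \<open>[-\<pi>, \<pi>]\<close>.
\<close>

subsection \<open>Vectors and matrices of fixed small size\<close>

lemma exhaust_5:
  fixes x :: 5
  shows "x = 1 \<or> x = 2 \<or> x = 3 \<or> x = 4 \<or> x = 5"
proof (induct x)
  case (of_int z)
  \<comment> \<open>The type \<open>5\<close> is represented by 0 to 4; the index 5 is 0.\<close>
  then have "z = 0 \<or> z = 1 \<or> z = 2 \<or> z = 3 \<or> z = 4" by fastforce
  then show ?case by auto
qed

lemma forall_5: "(\<forall>i::5. P i) \<longleftrightarrow> P 1 \<and> P 2 \<and> P 3 \<and> P 4 \<and> P 5"
  by (metis exhaust_5)

lemma vector_4 [simp]: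
  "(vector [x, y, z, w] :: ('a::zero)^4) $ 1 = x"
  "(vector [x, y, z, w] :: ('a::zero)^4) $ 2 = y"
  "(vector [x, y, z, w] :: ('a::zero)^4) $ 3 = z"
  "(vector [x, y, z, w] :: ('a::zero)^4) $ 4 = w"
  unfolding vector_def by simp_all

lemma vector_5 [simp]:
  "(vector [x, y, z, w, v] :: ('a::zero)^5) $ 1 = x"
  "(vector [x, y, z, w, v] :: ('a::zero)^5) $ 2 = y"
  "(vector [x, y, z, w, v] :: ('a::zero)^5) $ 3 = z"
  "(vector [x, y, z, w, v] :: ('a::zero)^5) $ 4 = w"
  "(vector [x, y, z, w, v] :: ('a::zero)^5) $ 5 = v"
  unfolding vector_def by simp_all

text \<open>Only permutations fixing 1 and 2 contribute. This is the shape of the coordinate matrix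
  of \<open>1\<close>, a diagonal matrix and two further elements of SU(2), one per row.\<close>

lemma det_4_lower_block:
  fixes A :: "'a::comm_ring_1^4^4"
  assumes "A $ 1 $ 2 = 0" "A $ 1 $ 3 = 0" "A $ 1 $ 4 = 0" "A $ 2 $ 3 = 0" "A $ 2 $ 4 = 0"
  shows "det A = A $ 1 $ 1 * A $ 2 $ 2 * (A $ 3 $ 3 * A $ 4 $ 4 - A $ 3 $ 4 * A $ 4 $ 3)"
proof -
  have f: "finite {2::4, 3, 4}" "1 \<notin> {2::4, 3, 4}" "finite {3::4, 4}" "2 \<notin> {3::4, 4}"
    "finite {4::4}" "3 \<notin> {4::4}"
    by auto
  show ?thesis
    unfolding det_def UNIV_4 sum_over_permutations_insert[OF f(1,2)]
      sum_over_permutations_insert[OF f(3,4)] sum_over_permutations_insert[OF f(5,6)] permutes_sing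
    by (simp add: sign_swap_id permutation_swap_id permutation_compose sign_compose sign_id
        swap_id_eq assms algebra_simps)
qed

text \<open>Polarization: the form of \<open>M - N\<close> vanishes at x, y and x + y, so by
  symmetry its bilinear form is zero. This provides the uniqueness behind \<open>THE\<close> in
  \<open>spectral_matrix\<close>.\<close>

lemma symmetric_matrix_eqI:
  fixes M N :: "real^'n^'n"
  assumes "transpose M = M" "transpose N = N" and eq: "\<And>x. x \<bullet> (M *v x) = x \<bullet> (N *v x)"
  shows "M = N"
proof -
  define D where "D = M - N"
  have "transpose D = D"
    using assms(1,2) by (simp add: D_def transpose_def vec_eq_iff)
  then have sym: "x \<bullet> (D *v y) = y \<bullet> (D *v x)" for x y
    using dot_lmul_matrix[of x D y] transpose_matrix_vector[of D x] by (simp add: inner_commute)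
  have zero: "x \<bullet> (D *v x) = 0" for x
    by (simp add: D_def matrix_vector_mult_diff_rdistrib inner_diff_right eq)
  have "x \<bullet> (D *v y) = 0" for x y
    using zero[of "x + y"] zero[of x] zero[of y] sym[of x y]
    by (simp add: matrix_vector_right_distrib inner_add_left inner_add_right)
  then have "D *v y = 0" for y
    using inner_eq_zero_iff by blast
  then have "D = 0"
    by (simp add: matrix_eq)
  then show ?thesis
    by (simp add: D_def)
qed

subsection \<open>The group SU(2)\<close>

lemma su2_matrix_nth [simp]:
  "su2_matrix a b $ 1 $ 1 = a" "su2_matrix a b $ 1 $ 2 = b"
  "su2_matrix a b $ 2 $ 1 = - cnj b" "su2_matrix a b $ 2 $ 2 = cnj a"
  by (simp_all add: su2_matrix_def)

lemma su2_matrix_mult: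
  "su2_matrix a b ** su2_matrix c d = su2_matrix (a * c - b * cnj d) (a * d + b * cnj c)"
  by (simp add: vec_eq_iff forall_2 matrix_matrix_mult_def sum_2 algebra_simps)

lemma mat1_su2_matrix: "mat 1 = su2_matrix 1 0"
  by (simp add: vec_eq_iff forall_2 mat_def)

lemma det_su2_matrix: "det (su2_matrix a b) = of_real ((cmod a)\<^sup>2 + (cmod b)\<^sup>2)"
  by (simp add: det_2 complex_norm_square[symmetric] del: of_real_power)

lemma SU2_iff: "A \<in> SU2 \<longleftrightarrow> (\<exists>a b. (cmod a)\<^sup>2 + (cmod b)\<^sup>2 = 1 \<and> A = su2_matrix a b)"
proof
  assume "A \<in> SU2"
  define a b c d where "a = A $ 1 $ 1" "b = A $ 1 $ 2" "c = A $ 2 $ 1" "d = A $ 2 $ 2"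
  note abcd = this
  from \<open>A \<in> SU2\<close> have 1: "a * cnj a + b * cnj b = 1" and 2: "c * cnj a + d * cnj b = 0"
    and 3: "a * d - b * c = 1"
    by (simp_all add: SU2_def vec_eq_iff forall_2 matrix_matrix_mult_def sum_2 mat_def det_2 abcd)
  \<comment> \<open>For instance, d = d (a cnj a + b cnj b) = cnj a (a d - b c) = cnj a.\<close>
  have "cnj a = d" "- cnj b = c"
    using 1 2 3 by algebra+
  then have A: "A = su2_matrix a b"
    by (simp add: vec_eq_iff forall_2 abcd)
  have "complex_of_real ((cmod a)\<^sup>2 + (cmod b)\<^sup>2) = 1"
    using 1 by (simp add: complex_norm_square del: of_real_power)
  with A show "\<exists>a b. (cmod a)\<^sup>2 + (cmod b)\<^sup>2 = 1 \<and> A = su2_matrix a b"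
    by (metis of_real_eq_1_iff)
next
  assume "\<exists>a b. (cmod a)\<^sup>2 + (cmod b)\<^sup>2 = 1 \<and> A = su2_matrix a b"
  then obtain a b where ab: "(cmod a)\<^sup>2 + (cmod b)\<^sup>2 = 1" and A: "A = su2_matrix a b"
    by blast
  have "a * cnj a + b * cnj b = 1"
    using ab by (metis complex_norm_square of_real_1 of_real_add)
  then show "A \<in> SU2"
    by (simp add: SU2_def A vec_eq_iff forall_2 matrix_matrix_mult_def sum_2 mat_def det_2
        algebra_simps)
qed

lemma su2_matrix_in_SU2: "(cmod a)\<^sup>2 + (cmod b)\<^sup>2 = 1 \<Longrightarrow> su2_matrix a b \<in> SU2"
  by (auto simp: SU2_iff)

lemma mat1_in_SU2: "mat 1 \<in> SU2"
  by (simp add: mat1_su2_matrix su2_matrix_in_SU2)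

lemma SU2_mult: "A ** B \<in> SU2" if A: "A \<in> SU2" and B: "B \<in> SU2"
proof -
  obtain a b c d where *: "A ** B = su2_matrix a b ** su2_matrix c d"
    using A B unfolding SU2_iff by metis
  obtain u v where uv: "A ** B = su2_matrix u v"
    unfolding * su2_matrix_mult by blast
  have "det (A ** B) = 1"
    using that by (simp add: det_mul SU2_def)
  then have "complex_of_real ((cmod u)\<^sup>2 + (cmod v)\<^sup>2) = 1"
    unfolding uv det_su2_matrix .
  then show ?thesis
    unfolding SU2_iff uv by (metis of_real_eq_1_iff)
qed

lemma SU2_inverse:
  assumes "A \<in> SU2"
  obtains B where "B \<in> SU2" "A ** B = mat 1" "B ** A = mat 1"
proof -
  obtain a b where ab: "(cmod a)\<^sup>2 + (cmod b)\<^sup>2 = 1" and A: "A = su2_matrix a b"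
    using assms by (auto simp: SU2_iff)
  have 1: "a * cnj a + b * cnj b = 1"
    using ab by (metis complex_norm_square of_real_1 of_real_add)
  show ?thesis
  proof
    show "su2_matrix (cnj a) (- b) \<in> SU2"
      using ab by (simp add: su2_matrix_in_SU2)
    show "A ** su2_matrix (cnj a) (- b) = mat 1" "su2_matrix (cnj a) (- b) ** A = mat 1"
      using 1 by (simp_all add: A su2_matrix_mult mat1_su2_matrix algebra_simps)
  qed
qed

text \<open>Trace 2 Re a and determinant 1 force the eigenvalues \<open>cis \<phi>\<close> and its
  conjugate, with \<open>cos \<phi> = Re a\<close>. A unit eigenvector is completed to an element of
  SU(2).\<close>

lemma SU2_diagonalize:
  assumes "A \<in> SU2"
  obtains U \<phi> where "U \<in> SU2" "0 \<le> \<phi>" "\<phi> \<le> pi" "A ** U = U ** su2_matrix (cis \<phi>) 0"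
proof -
  obtain a b where ab: "(cmod a)\<^sup>2 + (cmod b)\<^sup>2 = 1" and A: "A = su2_matrix a b"
    using assms by (auto simp: SU2_iff)
  have 1: "a * cnj a + b * cnj b = 1"
    using ab by (metis complex_norm_square of_real_1 of_real_add)
  have "\<bar>Re a\<bar> \<le> 1"
    using ab abs_Re_le_cmod[of a] by (smt (verit) power2_le_imp_le one_power2 zero_le_power2)
  define \<phi> where "\<phi> = arccos (Re a)"
  define e where "e = cis \<phi>"
  have \<phi>: "0 \<le> \<phi>" "\<phi> \<le> pi" "cos \<phi> = Re a"
    using \<open>\<bar>Re a\<bar> \<le> 1\<close> by (simp_all add: \<phi>_def arccos_lbound arccos_ubound abs_le_iff)
  have e: "e * cnj e = 1"
    by (simp add: e_def cis_cnj cis_mult)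
  have e': "e + cnj e = a + cnj a"
    using \<phi>(3) by (simp add: e_def complex_eq_iff)
  show ?thesis
  proof (cases "b = 0 \<and> a = e")
    case True
    show ?thesis
      by (rule that[of "mat 1" \<phi>]) (use True \<phi> A e_def mat1_in_SU2 in simp_all)
  next
    case False
    text \<open>The first column \<open>(v, w)\<close> of \<open>U\<close> is an eigenvector for the eigenvalue \<open>e\<close>; the
      formula \<open>(b, e - a)\<close> breaks down only if \<open>A\<close> is already diagonal.\<close>
    define r where "r = sqrt ((cmod b)\<^sup>2 + (cmod (e - a))\<^sup>2)"
    define v w where "v = b / of_real r" "w = (e - a) / of_real r"
    note vw = this
    have "(cmod b)\<^sup>2 + (cmod (e - a))\<^sup>2 \<noteq> 0"
      using False by (auto simp: sum_power2_eq_zero_iff)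
    then have r: "r \<noteq> 0" "(cmod b)\<^sup>2 + (cmod (e - a))\<^sup>2 = r\<^sup>2"
      by (auto simp: r_def)
    have "(cmod v)\<^sup>2 + (cmod w)\<^sup>2 = ((cmod b)\<^sup>2 + (cmod (e - a))\<^sup>2) / r\<^sup>2"
      by (simp add: vw norm_divide power_divide add_divide_distrib)
    then have n: "(cmod v)\<^sup>2 + (cmod w)\<^sup>2 = 1"
      using r by simp
    have "a * b + b * (e - a) = e * b"
      by algebra
    \<comment> \<open>This is the characteristic equation of \<open>A\<close> at \<open>e\<close>,
      which holds because \<open>e\<close> and \<open>cnj e\<close> have the same sum and product as
      the eigenvalues.\<close>
    moreover have "- cnj b * b + cnj a * (e - a) = e * (e - a)"
      using 1 e e' by algebra
    ultimately have vw': "a * v + b * w = e * v" "- cnj b * v + cnj a * w = e * w"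
      unfolding vw times_divide_eq_right add_divide_distrib[symmetric] by simp_all
    \<comment> \<open>Conjugation gives the eigenvalue equation for the second column (- cnj w, cnj
      v) with eigenvalue \<open>cnj e\<close>; its first entry suffices, since
      \<open>su2_matrix\<close> is determined by the first row.\<close>
    have "a * cnj w - b * cnj v = cnj w * cnj e"
      using arg_cong[OF vw'(2), of cnj] by (simp add: algebra_simps)
    then have "A ** su2_matrix v (- cnj w) = su2_matrix v (- cnj w) ** su2_matrix e 0"
      using vw'(1) by (simp add: A su2_matrix_mult algebra_simps)
    moreover have "su2_matrix v (- cnj w) \<in> SU2"
      using n by (simp add: su2_matrix_in_SU2)
    ultimately show ?thesis
      using that \<phi> e_def by blast
  qed
qed

subsection \<open>The spectral form as a Gram matrix\<close>

text \<open>The second row repeats the coordinates of the first, hence the factor 2 and the halves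
  in the Gram matrix below.\<close>

lemma inner_su2_matrix: "su2_matrix a b \<bullet> su2_matrix c d = 2 * (a \<bullet> c + b \<bullet> d)"
  by (simp add: inner_vec_def sum_2 inner_complex_def algebra_simps)

lemma det_real_combination:
  assumes "g \<in> tuples5"
  shows "det (\<Sum>i\<in>UNIV. x $ i *\<^sub>R g $ i) =
    complex_of_real (x \<bullet> ((\<chi> i j. (g $ i \<bullet> g $ j) / 2) *v x))"
proof -
  obtain a b where g: "g $ i = su2_matrix (a i) (b i)" for i
    using assms unfolding tuples5_def SU2_iff mem_Collect_eq by metis
  define S where "S = (\<Sum>i\<in>UNIV. x $ i *\<^sub>R g $ i)"
  \<comment> \<open>The shape \<open>su2_matrix\<close> is closed under real linear combinations, so
    the determinant of \<open>S\<close> is half its squared norm.\<close>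
  have "S = su2_matrix (\<Sum>i\<in>UNIV. x $ i *\<^sub>R a i) (\<Sum>i\<in>UNIV. x $ i *\<^sub>R b i)"
    by (simp add: S_def vec_eq_iff forall_2 g sum_negf)
  then have "det S = complex_of_real (S \<bullet> S / 2)"
    by (simp add: det_su2_matrix inner_su2_matrix power2_norm_eq_inner del: of_real_power)
  also have "S \<bullet> S / 2 = x \<bullet> ((\<chi> i j. (g $ i \<bullet> g $ j) / 2) *v x)"
    unfolding S_def inner_sum_left unfolding inner_sum_right
    by (simp add: inner_vec_def[of x] matrix_vector_mult_def sum_divide_distrib sum_distrib_left
        mult_ac)
  finally show ?thesis
    by (simp add: S_def)
qed

lemma spectral_matrix_eq:
  assumes "g \<in> tuples5"
  shows "spectral_matrix g = (\<chi> i j. (g $ i \<bullet> g $ j) / 2)"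
  unfolding spectral_matrix_def
proof (rule the_equality, intro conjI allI)
  show sym: "transpose (\<chi> i j. (g $ i \<bullet> g $ j) / 2) = (\<chi> i j. (g $ i \<bullet> g $ j) / 2)"
    by (simp add: transpose_def inner_commute)
  show "det (\<Sum>i\<in>UNIV. x $ i *\<^sub>R g $ i) =
      complex_of_real (x \<bullet> ((\<chi> i j. (g $ i \<bullet> g $ j) / 2) *v x))" for x
    by (rule det_real_combination[OF assms])
  show "M = (\<chi> i j. (g $ i \<bullet> g $ j) / 2)"
    if "transpose M = M \<and> (\<forall>x. det (\<Sum>i\<in>UNIV. x $ i *\<^sub>R g $ i) = complex_of_real (x \<bullet> (M *v x)))"
    for M
  proof (rule symmetric_matrix_eqI[OF _ sym])
    show "transpose M = M"
      using that by blast
    show "x \<bullet> (M *v x) = x \<bullet> ((\<chi> i j. (g $ i \<bullet> g $ j) / 2) *v x)" for x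
    proof -
      have "complex_of_real (x \<bullet> (M *v x)) =
          complex_of_real (x \<bullet> ((\<chi> i j. (g $ i \<bullet> g $ j) / 2) *v x))"
        using that by (simp only: det_real_combination[OF assms])
      then show ?thesis
        by (simp only: of_real_eq_iff)
    qed
  qed
qed

lemma spectral_matrix_in_Xi5:
  assumes "g \<in> tuples5"
  shows "spectral_matrix g \<in> Xi5"
proof -
  obtain a b where ab: "(cmod (a i))\<^sup>2 + (cmod (b i))\<^sup>2 = 1" and g: "g $ i = su2_matrix (a i) (b i)" for i
    using assms unfolding tuples5_def SU2_iff mem_Collect_eq by metis
  define M where "M = spectral_matrix g"
  have M: "M = (\<chi> i j. (g $ i \<bullet> g $ j) / 2)"
    using spectral_matrix_eq[OF assms] by (simp add: M_def)
  \<comment> \<open>The rows are the coordinates of the five entries in \<real>^4. As a Gram matrix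
    of a matrix with four columns, \<open>M\<close> is positive semidefinite of rank at most
    4.\<close>
  define G :: "real^4^5" where "G = (\<chi> i. vector [Re (a i), Im (a i), Re (b i), Im (b i)])"
  have MG: "M = G ** transpose G"
    by (simp add: M g inner_su2_matrix G_def vec_eq_iff matrix_matrix_mult_def transpose_def sum_4
        inner_complex_def)
  have "transpose M = M"
    by (simp add: MG matrix_transpose_mul)
  moreover have "0 \<le> x \<bullet> (M *v x)" for x
    by (simp add: MG matrix_vector_mul_assoc[symmetric] dot_lmul_matrix[symmetric]
        transpose_matrix_vector)
  moreover have "rank M \<le> 4"
    using rank_mul_le_left[of G "transpose G"] rank_bound[of G] by (simp add: MG)
  moreover have "M $ i $ i = 1" for i
    using ab[of i] by (simp add: M g inner_su2_matrix power2_norm_eq_inner[symmetric])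
  ultimately show ?thesis
    by (simp add: Xi5_def flip: M_def)
qed

text \<open>Since h and q have determinant 1, both tuples satisfy the same defining condition for
  \<open>M\<close>.\<close>

lemma spectral_matrix_tuple_rel:
  assumes "(g, g') \<in> tuple_rel"
  shows "spectral_matrix g' = spectral_matrix g"
proof -
  obtain h q where hq: "h \<in> SU2" "q \<in> SU2" and g': "\<And>i. g' $ i = h ** g $ i ** q"
    using assms by (auto simp: tuple_rel_def)
  have "(\<Sum>i\<in>UNIV. x $ i *\<^sub>R g' $ i) = h ** (\<Sum>i\<in>UNIV. x $ i *\<^sub>R g $ i) ** q" for x
  proof -
    have lin: "linear (\<lambda>m. h ** m ** q)"
      by (rule linearI) (simp_all add: vec_eq_iff matrix_matrix_mult_def sum.distrib
          scaleR_sum_right sum_distrib_left sum_distrib_right algebra_simps)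
    show ?thesis
      by (simp add: g' linear_sum[OF lin] linear_scale[OF lin])
  qed
  then show ?thesis
    using hq by (simp add: spectral_matrix_def det_mul SU2_def)
qed

subsection \<open>Classes of tuples\<close>

lemma equiv_tuple_rel: "equiv tuples5 tuple_rel"
proof (rule equivI)
  show "tuple_rel \<subseteq> tuples5 \<times> tuples5"
    by (auto simp: tuple_rel_def)
  show "refl_on tuples5 tuple_rel"
    by (auto simp: refl_on_def tuple_rel_def intro!: bexI[OF _ mat1_in_SU2])
  show "sym tuple_rel"
  proof (rule symI)
    fix g g' assume *: "(g, g') \<in> tuple_rel"
    then obtain h q where hq: "h \<in> SU2" "q \<in> SU2" and g': "\<And>i. g' $ i = h ** g $ i ** q"
      by (auto simp: tuple_rel_def)
    obtain h' where h': "h' \<in> SU2" "h' ** h = mat 1"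
      using SU2_inverse[OF hq(1)] by blast
    obtain q' where q': "q' \<in> SU2" "q ** q' = mat 1"
      using SU2_inverse[OF hq(2)] by blast
    have "h' ** g' $ i ** q' = (h' ** h) ** g $ i ** (q ** q')" for i
      by (simp only: g' matrix_mul_assoc)
    then have "g $ i = h' ** g' $ i ** q'" for i
      using h' q' by simp
    with * h'(1) q'(1) show "(g', g) \<in> tuple_rel"
      unfolding tuple_rel_def by blast
  qed
  show "trans tuple_rel"
  proof (rule transI)
    fix g g' g'' assume *: "(g, g') \<in> tuple_rel" "(g', g'') \<in> tuple_rel"
    then obtain h q h' q' where hq: "h \<in> SU2" "q \<in> SU2" "h' \<in> SU2" "q' \<in> SU2"
      and g': "\<And>i. g' $ i = h ** g $ i ** q" "\<And>i. g'' $ i = h' ** g' $ i ** q'"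
      by (auto simp: tuple_rel_def)
    have "g'' $ i = (h' ** h) ** g $ i ** (q ** q')" for i
      by (simp only: g' matrix_mul_assoc)
    with * SU2_mult[OF hq(3,1)] SU2_mult[OF hq(2,4)] show "(g, g'') \<in> tuple_rel"
      unfolding tuple_rel_def by blast
  qed
qed

lemma Pi5_eq_class:
  assumes "X \<in> Pi5" "g \<in> X"
  shows "X = tuple_rel `` {g}" "g \<in> tuples5"
proof -
  obtain g0 where g0: "X = tuple_rel `` {g0}" "g0 \<in> tuples5"
    using assms(1) by (auto simp: Pi5_def elim: quotientE)
  then have "(g0, g) \<in> tuple_rel"
    using assms(2) by simp
  then show "X = tuple_rel `` {g}" "g \<in> tuples5"
    using g0(1) equiv_class_eq[OF equiv_tuple_rel] by (auto simp: tuple_rel_def)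
qed

text \<open>The form is constant on a class, which gives \<open>the_elem\<close> its
  meaning.\<close>

lemma spectral_of_class_eq:
  assumes "X \<in> Pi5" "g \<in> X"
  shows "spectral_of_class X = spectral_matrix g"
proof -
  have "spectral_matrix ` X = {spectral_matrix g}"
    using assms spectral_matrix_tuple_rel Pi5_eq_class(1)[OF assms] by blast
  then show ?thesis
    by (simp add: spectral_of_class_def)
qed

lemma to_tilde_in_Xi5_tilde:
  assumes "X \<in> Pi5"
  shows "to_tilde X \<in> Xi5_tilde"
proof -
  obtain g where "g \<in> X"
    using assms in_quotient_imp_non_empty[OF equiv_tuple_rel] unfolding Pi5_def by blast
  then show ?thesis
    using assms Pi5_eq_class(2) spectral_of_class_eq spectral_matrix_in_Xi5
    by (auto simp: to_tilde_def Xi5_tilde_def)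
qed

section \<open>The transformation on tuples and on classes\<close>

lemma transform_tuple_in_tuples5: "g \<in> tuples5 \<Longrightarrow> transform_tuple g \<in> tuples5"
  by (simp add: tuples5_def transform_tuple_def forall_5 SU2_mult)

text \<open>Between tuples with first entry \<open>1\<close> the relation is simultaneous conjugation, with which
  the transformation commutes.\<close>

lemma transform_tuple_rel:
  assumes "(g, g') \<in> tuple_rel" "g $ 1 = mat 1" "g' $ 1 = mat 1"
  shows "(transform_tuple g, transform_tuple g') \<in> tuple_rel"
proof -
  obtain h q where hq: "h \<in> SU2" "q \<in> SU2" and g': "\<And>i. g' $ i = h ** g $ i ** q"
    and tup: "g \<in> tuples5" "g' \<in> tuples5"
    using assms(1) by (auto simp: tuple_rel_def)
  have "h ** q = mat 1"
    using g'[of 1] assms(2,3) by simp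
  then have "q ** h = mat 1"
    by (simp add: matrix_left_right_inverse)
  \<comment> \<open>The inner factor \<open>q ** h\<close> cancels, so the product of two conjugated
    entries is the conjugated product.\<close>
  have "h ** g $ 2 ** q ** (h ** g $ 3 ** q) = h ** g $ 2 ** (q ** h) ** g $ 3 ** q"
    by (simp only: matrix_mul_assoc)
  also have "\<dots> = h ** (g $ 2 ** g $ 3) ** q"
    by (simp add: \<open>q ** h = mat 1\<close> matrix_mul_assoc)
  finally have "h ** g $ 2 ** q ** (h ** g $ 3 ** q) = h ** (g $ 2 ** g $ 3) ** q" .
  then have "\<forall>i. transform_tuple g' $ i = h ** transform_tuple g $ i ** q"
    using \<open>h ** q = mat 1\<close> assms(2) by (simp add: forall_5 transform_tuple_def g')
  then show ?thesis
    using hq tup by (auto simp: tuple_rel_def transform_tuple_in_tuples5)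
qed

text \<open>All members of the union are one class by \<open>transform_tuple_rel\<close>, so any one
  representative with first entry \<open>1\<close> computes it.\<close>

lemma transform_class_eq:
  assumes "X \<in> Pi5" "g \<in> X" "g $ 1 = mat 1"
  shows "transform_class X = tuple_rel `` {transform_tuple g}"
proof -
  have "tuple_rel `` {transform_tuple g'} = tuple_rel `` {transform_tuple g}"
    if "g' \<in> X" "g' $ 1 = mat 1" for g'
    using transform_tuple_rel[of g g'] that assms Pi5_eq_class(1)[OF assms(1,2)]
      equiv_class_eq[OF equiv_tuple_rel] by (metis Image_singleton_iff)
  then show ?thesis
    using assms unfolding transform_class_def by blast
qed

section \<open>Normalized representatives and their angles\<close>

definition normal_tuple :: "real \<Rightarrow> (nat \<Rightarrow> complex) \<Rightarrow> (nat \<Rightarrow> complex) \<Rightarrow> mat2^5" where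
  "normal_tuple \<phi> a b = vector [mat 1, su2_matrix (cis \<phi>) 0,
     su2_matrix (a 1) (b 1), su2_matrix (a 2) (b 2), su2_matrix (a 3) (b 3)]"

lemma normal_tuple_exists:
  assumes "X \<in> Pi5"
  obtains \<phi> a b where "0 \<le> \<phi>" "\<phi> \<le> pi" "normal_tuple \<phi> a b \<in> X"
proof -
  obtain g where g: "X = tuple_rel `` {g}" "g \<in> tuples5"
    using assms by (auto simp: Pi5_def elim: quotientE)
  then have SU: "g $ i \<in> SU2" for i
    by (simp add: tuples5_def)
  obtain k where k: "k \<in> SU2" "g $ 1 ** k = mat 1" "k ** g $ 1 = mat 1"
    using SU2_inverse[OF SU] by blast
  obtain U \<phi> where U: "U \<in> SU2" "0 \<le> \<phi>" "\<phi> \<le> pi"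
      "(k ** g $ 2) ** U = U ** su2_matrix (cis \<phi>) 0"
    using SU2_diagonalize[OF SU2_mult[OF k(1) SU]] by blast
  obtain V where V: "V \<in> SU2" "V ** U = mat 1"
    using SU2_inverse[OF U(1)] by blast
  have Vk: "V ** k \<in> SU2"
    using V k by (simp add: SU2_mult)
  \<comment> \<open>Multiplication by \<open>k\<close>, the inverse of the first entry, makes that
    entry \<open>1\<close>; conjugation by \<open>U\<close> keeps it and diagonalizes the
    second.\<close>
  define g' where "g' = (\<chi> i. (V ** k) ** g $ i ** U)"
  have SU': "g' $ i \<in> SU2" for i
    using SU Vk U(1) by (simp add: g'_def SU2_mult)
  then have "(g, g') \<in> tuple_rel"
    using Vk U(1) g(2) by (auto simp: tuple_rel_def tuples5_def g'_def)
  have "g' $ 1 = V ** (k ** g $ 1) ** U"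
    by (simp add: g'_def matrix_mul_assoc)
  then have 1: "g' $ 1 = mat 1"
    by (simp add: k V)
  have "g' $ 2 = V ** ((k ** g $ 2) ** U)"
    by (simp add: g'_def matrix_mul_assoc)
  also have "\<dots> = (V ** U) ** su2_matrix (cis \<phi>) 0"
    by (simp only: U matrix_mul_assoc)
  finally have 2: "g' $ 2 = su2_matrix (cis \<phi>) 0"
    by (simp add: V)
  obtain a b where ab: "g' $ i = su2_matrix (a i) (b i)" for i
    using SU' unfolding SU2_iff by metis
  have "g' = normal_tuple \<phi> (\<lambda>k. a (of_nat (k + 2))) (\<lambda>k. b (of_nat (k + 2)))"
    using 1 2 ab by (simp add: vec_eq_iff[of g'] forall_5 normal_tuple_def)
  with \<open>(g, g') \<in> tuple_rel\<close> g(1) U(2,3) show ?thesis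
    using that by blast
qed

lemma angle_diffs_exists:
  assumes "X \<in> Pi5"
  shows "\<exists>\<delta>. angle_diffs X \<delta>"
proof -
  obtain \<phi> a b where N: "0 \<le> \<phi>" "\<phi> \<le> pi" "normal_tuple \<phi> a b \<in> X"
    using normal_tuple_exists[OF assms] .
  \<comment> \<open>For \<open>b k = 0\<close>, where any angle is allowed, this is
    \<open>Arg 0 = 0\<close>.\<close>
  define \<theta> where "\<theta> k = Arg (b k)" for k
  \<comment> \<open>The raw difference may leave [-\<pi>, \<pi>]; \<open>Arg\<close> brings it back
    modulo 2\<pi>.\<close>
  have "\<exists>d. \<bar>d\<bar> \<le> pi \<and> cis d = cis (\<theta> i - \<theta> j)" for i j
    using cis_Arg_unique cis_Arg[of "cis (\<theta> i - \<theta> j)"] Arg_bounded[of "cis (\<theta> i - \<theta> j)"]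
    by (intro exI[of _ "Arg (cis (\<theta> i - \<theta> j))"]) (auto simp: sgn_div_norm)
  then obtain \<delta> where "\<bar>\<delta> i j\<bar> \<le> pi \<and> cis (\<delta> i j) = cis (\<theta> i - \<theta> j)" for i j
    by metis
  moreover have "b k = complex_of_real (cmod (b k)) * cis (\<theta> k)" for k
    using rcis_cmod_Arg[of "b k"] by (simp add: \<theta>_def rcis_def)
  ultimately show ?thesis
    using N unfolding angle_diffs_def normal_tuple_def by blast
qed

subsection \<open>The transformed coefficients\<close>

lemma spectral_matrix_normal_tuple:
  fixes \<phi> :: real and a b :: "nat \<Rightarrow> complex"
  defines "g \<equiv> normal_tuple \<phi> a b"
  defines "M \<equiv> spectral_matrix g"
  assumes "g \<in> tuples5"
  shows "coef_p M = cos \<phi>"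
    "k \<in> {1, 2, 3} \<Longrightarrow> coef_q M k = Re (a k)"
    "k \<in> {1, 2, 3} \<Longrightarrow> coef_r M k = cos \<phi> * Re (a k) + sin \<phi> * Im (a k)"
    "k \<in> {1, 2, 3} \<Longrightarrow> l \<in> {1, 2, 3} \<Longrightarrow> coef_t M k l = a k \<bullet> a l + b k \<bullet> b l"
  using assms(3)
  by (auto simp: M_def spectral_matrix_eq coef_p_def coef_q_def coef_r_def coef_t_def
      g_def normal_tuple_def mat1_su2_matrix inner_su2_matrix inner_complex_def)

text \<open>Normal form is preserved, so one set of coefficient formulas serves before and after the
  transformation.\<close>

lemma transform_normal_tuple:
  "transform_tuple (normal_tuple \<phi> a b) =
    normal_tuple \<phi> (a(1 := cis \<phi> * a 1)) (b(1 := cis \<phi> * b 1))"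
  by (simp add: transform_tuple_def normal_tuple_def su2_matrix_mult)

text \<open>The minor is the Gram matrix of the rows of \<open>A\<close>, the coordinates of four
  entries of the tuple, so its determinant is the square of \<open>det A\<close>.\<close>

lemma det_minor4_normal_tuple:
  assumes "normal_tuple \<phi> a b \<in> tuples5" "j \<in> {2, 3}"
  shows "det (minor4 (spectral_matrix (normal_tuple \<phi> a b)) j) =
    (sin \<phi> * Im (b 1 * cnj (b j)))\<^sup>2"
proof -
  define A :: "real^4^4" where "A = vector [
    vector [1, 0, 0, 0],
    vector [cos \<phi>, sin \<phi>, 0, 0],
    vector [Re (a 1), Im (a 1), Re (b 1), Im (b 1)],
    vector [Re (a j), Im (a j), Re (b j), Im (b j)]]"
  have SU: "su2_matrix (a k) (b k) \<in> SU2" if "k \<in> {1, 2, 3}" for k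
    using assms(1) that by (auto simp: tuples5_def normal_tuple_def forall_5)
  \<comment> \<open>Unit length matches the constant diagonal of \<open>minor4\<close> with that of
    \<open>A ** transpose A\<close>.\<close>
  then have n: "a k \<bullet> a k + b k \<bullet> b k = 1" if "k \<in> {1, 2, 3}" for k
  proof -
    have "complex_of_real ((cmod (a k))\<^sup>2 + (cmod (b k))\<^sup>2) = 1"
      using SU[OF that]
      by (simp add: SU2_def det_su2_matrix del: of_real_add of_real_power)
    then show ?thesis
      by (simp only: of_real_eq_1_iff power2_norm_eq_inner)
  qed
  have "minor4 (spectral_matrix (normal_tuple \<phi> a b)) j = A ** transpose A"
    using assms n[of 1] n[of j]
    by (auto simp: minor4_def spectral_matrix_normal_tuple vec_eq_iff forall_4
        matrix_matrix_mult_def transpose_def sum_4 A_def inner_complex_def power2_eq_square[symmetric]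
        mult.commute)
  moreover have "det A = - (sin \<phi> * Im (b 1 * cnj (b j)))"
    by (subst det_4_lower_block) (simp_all add: A_def algebra_simps)
  ultimately show ?thesis
    by (simp add: det_mul power2_eq_square)
qed

text \<open>The new coefficient is the real part of
  \<open>cis \<phi> * (a 1 * cnj (a j) + b 1 * cnj (b j))\<close>. Substituting
  \<open>sin \<phi> * Im (a k) = coef_r M k - coef_p M * coef_q M k\<close> removes the imaginary
  parts of the \<open>a k\<close>; only the \<open>b\<close> term remains.\<close>

lemma coef_t_transform:
  fixes \<phi> :: real and a b :: "nat \<Rightarrow> complex"
  defines "g \<equiv> normal_tuple \<phi> a b"
  defines "M \<equiv> spectral_matrix g"
  assumes "g \<in> tuples5" "j \<in> {2, 3}"
  shows "coef_t (spectral_matrix (transform_tuple g)) 1 j =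
    coef_p M * coef_t M 1 j - coef_q M j * coef_r M 1 + coef_q M 1 * coef_r M j
      - sin \<phi> * Im (b 1 * cnj (b j))"
proof -
  have "normal_tuple \<phi> (a(1 := cis \<phi> * a 1)) (b(1 := cis \<phi> * b 1)) \<in> tuples5"
    using transform_tuple_in_tuples5[OF assms(3)] by (simp add: g_def transform_normal_tuple)
  then show ?thesis
    using assms(3,4) unfolding M_def g_def transform_normal_tuple
    by (auto simp: spectral_matrix_normal_tuple inner_complex_def algebra_simps)
qed

text \<open>On [-\<pi>, \<pi>] the sign of an angle is that of its sine, up to zeros of the sine;
  this turns the sign rule for angles into one for determinants.\<close>

lemma sin_sign:
  fixes d :: real
  assumes "\<bar>d\<bar> \<le> pi"
  shows "\<bar>sin d\<bar> = (if 0 \<le> d then sin d else - sin d)"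
  using assms sin_ge_zero[of d] sin_ge_zero[of "- d"] by auto

text \<open>The tuple that supplies the angles also computes both forms. Ambiguity of \<delta> is
  harmless: if \<open>b 1\<close> or \<open>b j\<close> is zero, \<open>sin \<phi> = 0\<close>, or
  the difference is \<pi> or -\<pi>, the determinant vanishes.\<close>

lemma coef_t_transform_angle:
  assumes X: "X \<in> Pi5" and \<delta>: "angle_diffs X \<delta>" and j: "j \<in> {2, 3}"
  defines "M \<equiv> spectral_of_class X"
  shows "coef_t (spectral_of_class (transform_class X)) 1 j =
    coef_p M * coef_t M 1 j - coef_q M j * coef_r M 1 + coef_q M 1 * coef_r M j
      + (if 0 \<le> \<delta> 1 j then - sqrt (det (minor4 M j)) else sqrt (det (minor4 M j)))"
proof -
  obtain \<phi> a b \<theta> where \<phi>: "0 \<le> \<phi>" "\<phi> \<le> pi" and gX: "normal_tuple \<phi> a b \<in> X"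
    and b: "\<And>k. k \<in> {1..3} \<Longrightarrow> b k = complex_of_real (cmod (b k)) * cis (\<theta> k)"
    and d: "\<And>k l. k \<in> {1..3} \<Longrightarrow> l \<in> {1..3} \<Longrightarrow> k < l \<Longrightarrow>
      \<bar>\<delta> k l\<bar> \<le> pi \<and> cis (\<delta> k l) = cis (\<theta> k - \<theta> l)"
    using \<delta> unfolding angle_diffs_def normal_tuple_def by blast
  define g where "g = normal_tuple \<phi> a b"
  have g: "g \<in> X" "g \<in> tuples5" "g $ 1 = mat 1"
    using gX Pi5_eq_class[OF X] by (auto simp: g_def normal_tuple_def)
  have M: "M = spectral_matrix g"
    by (simp add: M_def spectral_of_class_eq[OF X g(1)])
  have tg: "transform_tuple g \<in> tuples5"
    by (rule transform_tuple_in_tuples5[OF g(2)])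
  have tX: "transform_class X = tuple_rel `` {transform_tuple g}"
    by (rule transform_class_eq[OF X g(1,3)])
  then have M': "spectral_of_class (transform_class X) = spectral_matrix (transform_tuple g)"
    using tg equiv_class_self[OF equiv_tuple_rel tg]
    by (intro spectral_of_class_eq) (auto simp: Pi5_def intro: quotientI)
  define S where "S = sin \<phi> * Im (b 1 * cnj (b j))"
  \<comment> \<open>The range of \<phi> makes this nonnegative, so the sign of \<open>S\<close>
    comes from \<open>sin (\<delta> 1 j)\<close> alone.\<close>
  define c where "c = sin \<phi> * cmod (b 1) * cmod (b j)"
  have "0 \<le> c"
    using \<phi> by (simp add: c_def sin_ge_zero)
  have dj: "\<bar>\<delta> 1 j\<bar> \<le> pi" "cis (\<delta> 1 j) = cis (\<theta> 1 - \<theta> j)"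
    using d[of 1 j] j by auto
  have "b 1 * cnj (b j) = complex_of_real (cmod (b 1) * cmod (b j)) * cis (\<delta> 1 j)"
  proof -
    have "b 1 * cnj (b j) = (complex_of_real (cmod (b 1)) * cis (\<theta> 1)) *
        cnj (complex_of_real (cmod (b j)) * cis (\<theta> j))"
      using j by (intro arg_cong2[of _ _ _ _ "\<lambda>x y. x * cnj y"] b) auto
    also have "\<dots> = complex_of_real (cmod (b 1) * cmod (b j)) * (cis (\<theta> 1) * cis (- \<theta> j))"
      by (simp only: complex_cnj_mult complex_cnj_complex_of_real cis_cnj of_real_mult mult_ac)
    finally show ?thesis
      by (simp only: dj(2) cis_mult diff_conv_add_uminus)
  qed
  then have S: "S = c * sin (\<delta> 1 j)"
    by (simp add: S_def c_def)
  have "sqrt (det (minor4 M j)) = \<bar>S\<bar>"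
    using det_minor4_normal_tuple[of \<phi> a b j] g(2) j by (simp add: M g_def S_def)
  also have "\<dots> = (if 0 \<le> \<delta> 1 j then S else - S)"
    using sin_sign[OF dj(1)] \<open>0 \<le> c\<close> by (simp add: S abs_mult)
  finally show ?thesis
    using coef_t_transform[of \<phi> a b j] g(2) j unfolding M M' g_def S_def by (auto split: if_splits)
qed

text \<open>Left multiplication by \<open>g $ 2\<close> is an isometry, so the new r_1 is the old
  q_1. The new q_1 pairs \<open>g $ 3\<close> with the inverse of \<open>g $ 2\<close>, which equals
  2p - \<open>g $ 2\<close>.\<close>

lemma coef_transform_class:
  assumes X: "X \<in> Pi5"
  defines "M \<equiv> spectral_of_class X" and "M' \<equiv> spectral_of_class (transform_class X)"
  shows "transform_class X \<in> Pi5"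
    and "coef_p M' = coef_p M" "coef_q M' 2 = coef_q M 2" "coef_q M' 3 = coef_q M 3"
      "coef_q M' 1 = - coef_r M 1 + 2 * coef_p M * coef_q M 1"
      "coef_r M' 1 = coef_q M 1" "coef_r M' 2 = coef_r M 2" "coef_r M' 3 = coef_r M 3"
      "coef_t M' 2 3 = coef_t M 2 3"
proof -
  obtain \<phi> a b where gX: "normal_tuple \<phi> a b \<in> X"
    using normal_tuple_exists[OF X] by metis
  define g where "g = normal_tuple \<phi> a b"
  have g: "g \<in> X" "g \<in> tuples5" "g $ 1 = mat 1"
    using gX Pi5_eq_class[OF X] by (auto simp: g_def normal_tuple_def)
  have tg: "transform_tuple g \<in> tuples5"
    by (rule transform_tuple_in_tuples5[OF g(2)])
  have tX: "transform_class X = tuple_rel `` {transform_tuple g}"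
    by (rule transform_class_eq[OF X g(1,3)])
  then show tPi: "transform_class X \<in> Pi5"
    using tg by (auto simp: Pi5_def intro: quotientI)
  have M: "M = spectral_matrix (normal_tuple \<phi> a b)"
    by (simp add: M_def spectral_of_class_eq[OF X g(1)] g_def)
  have M': "M' = spectral_matrix (normal_tuple \<phi> (a(1 := cis \<phi> * a 1)) (b(1 := cis \<phi> * b 1)))"
    using spectral_of_class_eq[OF tPi] equiv_class_self[OF equiv_tuple_rel tg]
    by (simp add: M'_def tX g_def transform_normal_tuple)
  have N: "normal_tuple \<phi> a b \<in> tuples5"
    "normal_tuple \<phi> (a(1 := cis \<phi> * a 1)) (b(1 := cis \<phi> * b 1)) \<in> tuples5"
    using g(2) tg by (simp_all add: g_def transform_normal_tuple)
  note coefs = spectral_matrix_normal_tuple[OF N(1), folded M]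
    spectral_matrix_normal_tuple[OF N(2), folded M']
  \<comment> \<open>This is what remains of the new r_1 after the mixed terms in
    \<open>Im (a 1)\<close> cancel.\<close>
  have "cos \<phi> * (cos \<phi> * Re (a 1)) + sin \<phi> * (sin \<phi> * Re (a 1)) = Re (a 1)"
    using sin_cos_squared_add2[of \<phi>] by algebra
  then show "coef_p M' = coef_p M" "coef_q M' 2 = coef_q M 2" "coef_q M' 3 = coef_q M 3"
      "coef_q M' 1 = - coef_r M 1 + 2 * coef_p M * coef_q M 1"
      "coef_r M' 1 = coef_q M 1" "coef_r M' 2 = coef_r M 2" "coef_r M' 3 = coef_r M 3"
      "coef_t M' 2 3 = coef_t M 2 3"
    by (simp_all add: coefs algebra_simps)
qed

theorem theorem4p2:
  "\<exists>F. F \<in> Xi5_tilde \<rightarrow> Xi5_tilde \<and>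
     (\<forall>X\<in>Pi5. F (to_tilde X) = to_tilde (transform_class X)) \<and>
     (\<forall>M X M' X'. (M, X) \<in> Xi5_tilde \<longrightarrow> F (M, X) = (M', X') \<longrightarrow>
        coef_p M' = coef_p M \<and>
        coef_q M' 2 = coef_q M 2 \<and> coef_q M' 3 = coef_q M 3 \<and>
        coef_q M' 1 = - coef_r M 1 + 2 * coef_p M * coef_q M 1 \<and>
        coef_r M' 1 = coef_q M 1 \<and>
        coef_r M' 2 = coef_r M 2 \<and> coef_r M' 3 = coef_r M 3 \<and>
        (\<exists>\<delta>. angle_diffs X \<delta>) \<and>
        (\<forall>\<delta>. angle_diffs X \<delta> \<longrightarrow> (\<forall>j\<in>{2, 3}.
           coef_t M' 1 j =
             coef_p M * coef_t M 1 j - coef_q M j * coef_r M 1 + coef_q M 1 * coef_r M j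
             + (if 0 \<le> \<delta> 1 j then - sqrt (det (minor4 M j)) else sqrt (det (minor4 M j))))) \<and>
        coef_t M' 2 3 = coef_t M 2 3)" (is "\<exists>F. _ F \<and> _ F \<and> ?Q F")
\<comment> \<open>The witness reads only the class: on the covering, \<open>M\<close> is already
  determined by \<open>X\<close>.\<close>
proof (intro exI[of _ "\<lambda>(M, X). to_tilde (transform_class X)"] conjI)
  show "(\<lambda>(M, X). to_tilde (transform_class X)) \<in> Xi5_tilde \<rightarrow> Xi5_tilde"
  proof (intro funcsetI, clarify)
    fix M X assume "(M, X) \<in> Xi5_tilde"
    then have "X \<in> Pi5"
      by (simp add: Xi5_tilde_def)
    then show "to_tilde (transform_class X) \<in> Xi5_tilde"
      by (intro to_tilde_in_Xi5_tilde coef_transform_class(1))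
  qed
  show "\<forall>X\<in>Pi5. (\<lambda>(M, X). to_tilde (transform_class X)) (to_tilde X) = to_tilde (transform_class X)"
    by (simp add: to_tilde_def)
next
  have "X \<in> Pi5 \<and> M = spectral_of_class X \<and> M' = spectral_of_class (transform_class X)"
    if "(M, X) \<in> Xi5_tilde" "(\<lambda>(M, X). to_tilde (transform_class X)) (M, X) = (M', X')"
    for M X M' X'
    using that by (auto simp: Xi5_tilde_def to_tilde_def)
  then show "?Q (\<lambda>(M, X). to_tilde (transform_class X))"
    by (metis coef_transform_class angle_diffs_exists coef_t_transform_angle)
qed

end
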